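(* Let $\phi=(\sqrt5+1)/2$. There is a constant $c<2$ such that the following holds for weight-biased leftist heaps and also for rank-biased leftist heaps: there exist sequences of operations (starting from heaps obtained from $\mathrm{empty}$ and $\mathrm{single}$ and applying $\mathrm{union}$, $\mathrm{delmin}$, etc. to previously obtained heaps) in which the heaps get arbitrarily large and in which the actual costs satisfy: $\mathrm{empty}$, $\mathrm{isEmpty}(x)$, $\mathrm{min}(x)$ and $\mathrm{single}(a)$ cost $0$, every $\mathrm{delmin}(x)$ costs at least $\log_\phi|x|-c$, and every $\mathrm{union}(x,y)$ costs at least $\log_\phi(|x|+|y|)-c$.
   Context: Binary trees with labels from a totally ordered set $A$: $\langle\rangle$ is the empty tree, $\langle t,a,u\rangle$ has left subtree $t$, root label $a$, right subtree $u$; $\langle a\rangle=\langle\langle\rangle,a,\langle\rangle\rangle$. Weight: $\#\langle\rangle=0$, $\#\langle t,a,u\rangle=\#t+\#u+1$; $|x|=\#x+1$. Rank: $\mathrm{rank}\langle\rangle=0$, $\mathrm{rank}\langle t,a,u\rangle=\mathrm{rank}\,u+1$. A heap satisfies the heap property (every label is $\le$ all labels in its subtrees); it is weight-biased if $\#t\ge\#u$ at every node $\langle t,a,u\rangle$, and rank-biased if $\mathrm{rank}\,t\ge\mathrm{rank}\,u$ at every node. Operations: $\mathrm{empty}=\langle\rangle$; $\mathrm{isEmpty}(x)$ tests $x=\langle\rangle$; $\mathrm{single}(a)=\langle a\rangle$; $\mathrm{min}(\langle\rangle)=\infty$ (larger than all labels), $\mathrm{min}\langle t,a,u\rangle=a$;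 $\mathrm{union}(x,y)=x\oplus y$; $\mathrm{delmin}\langle t,a,u\rangle=t\oplus u$. Meld: $\langle\rangle\oplus\langle\rangle=\langle\rangle$; $\langle t,a,u\rangle\oplus y=\mathrm{bal}\langle t,a,u\oplus y\rangle$ if $a\le\mathrm{min}(y)$; otherwise $x\oplus\langle t,a,u\rangle=\mathrm{bal}\langle t,a,x\oplus u\rangle$. For weight-biased heaps $\mathrm{bal}\langle t,a,u\rangle=\langle t,a,u\rangle$ if $\#t>\#u$ and $\langle u,a,t\rangle$ if $\#t\le\#u$; for rank-biased heaps $\mathrm{bal}\langle t,a,u\rangle=\langle t,a,u\rangle$ if $\mathrm{rank}\,t>\mathrm{rank}\,u$ and $\langle u,a,t\rangle$ if $\mathrm{rank}\,t\le\mathrm{rank}\,u$. Actual cost counts comparisons $a\le\mathrm{min}(y)$ made while unfolding $\oplus$, including comparisons with $\infty$: $T_\oplus(\langle\rangle,\langle\rangle)=0$, otherwise $T_\oplus(x,y)=1+T_\oplus$ of the recursive call. So $\mathrm{union}(x,y)$ costs $T_\oplus(x,y)$, $\mathrm{delmin}\langle t,a,u\rangle$ costs $T_\oplus(t,u)$, and the other operations cost $0$. *)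

theory Defs
  imports Complex_Main "HOL-Library.Tree" "HOL-Library.Multiset" "HOL-Library.Extended"
begin

text \<open>
  Trees, their weight \<open>size t\<close>, the number \<open>size1 t = size t + 1\<close> (written \<open>|t|\<close> in the
  literature) and the heap property \<open>heap t\<close> are those of \<open>HOL-Library.Tree\<close>.
\<close>

fun rank :: "'a tree \<Rightarrow> nat" where
  "rank \<langle>\<rangle> = 0"
| "rank \<langle>t, a, u\<rangle> = rank u + 1"

datatype bias = Weight_Biased | Rank_Biased

fun key :: "bias \<Rightarrow> 'a tree \<Rightarrow> nat" where
  "key Weight_Biased t = size t"
| "key Rank_Biased t = rank t"

fun leftist :: "bias \<Rightarrow> 'a tree \<Rightarrow> bool" where
  "leftist v \<langle>\<rangle> = True"
| "leftist v \<langle>t, a, u\<rangle> = (key v t \<ge> key v u \<and> leftist v t \<and> leftist v u)"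

text \<open>Children with equal keys are swapped.\<close>

definition bal :: "bias \<Rightarrow> 'a tree \<Rightarrow> 'a \<Rightarrow> 'a tree \<Rightarrow> 'a tree" where
  "bal v t a u = (if key v t > key v u then \<langle>t, a, u\<rangle> else \<langle>u, a, t\<rangle>)"

fun find_min :: "'a tree \<Rightarrow> 'a extended" where
  "find_min \<langle>\<rangle> = Pinf"
| "find_min \<langle>t, a, u\<rangle> = Fin a"

text \<open>
  In the two middle equations exactly one argument is empty; the comparison is then one with
  \<open>find_min \<langle>\<rangle> = Pinf\<close>, whose outcome is known, but it still counts in \<open>T_meld\<close>.
\<close>

fun meld :: "bias \<Rightarrow> 'a::linorder tree \<Rightarrow> 'a tree \<Rightarrow> 'a tree" where
  "meld v \<langle>\<rangle> \<langle>\<rangle> = \<langle>\<rangle>"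
| "meld v \<langle>t, a, u\<rangle> \<langle>\<rangle> = bal v t a (meld v u \<langle>\<rangle>)"
| "meld v \<langle>\<rangle> \<langle>s, b, w\<rangle> = bal v s b (meld v \<langle>\<rangle> w)"
| "meld v \<langle>t, a, u\<rangle> \<langle>s, b, w\<rangle> =
    (if Fin a \<le> find_min \<langle>s, b, w\<rangle>
     then bal v t a (meld v u \<langle>s, b, w\<rangle>)
     else bal v s b (meld v \<langle>t, a, u\<rangle> w))"

fun T_meld :: "'a::linorder tree \<Rightarrow> 'a tree \<Rightarrow> nat" where
  "T_meld \<langle>\<rangle> \<langle>\<rangle> = 0"
| "T_meld \<langle>t, a, u\<rangle> \<langle>\<rangle> = 1 + T_meld u \<langle>\<rangle>"
| "T_meld \<langle>\<rangle> \<langle>s, b, w\<rangle> = 1 + T_meld \<langle>\<rangle> w"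
| "T_meld \<langle>t, a, u\<rangle> \<langle>s, b, w\<rangle> =
    1 + (if Fin a \<le> find_min \<langle>s, b, w\<rangle>
         then T_meld u \<langle>s, b, w\<rangle>
         else T_meld \<langle>t, a, u\<rangle> w)"

datatype 'a heap_op =
    Op_Empty
  | Op_Single 'a
  | Op_Is_Empty "'a tree"
  | Op_Min "'a tree"
  | Op_Union "'a tree" "'a tree"
  | Op_Delmin "'a tree"

text \<open>The value on \<open>Op_Delmin \<langle>\<rangle>\<close> is immaterial: this operation is never executed.\<close>

fun cost :: "'a::linorder heap_op \<Rightarrow> nat" where
  "cost Op_Empty = 0"
| "cost (Op_Single a) = 0"
| "cost (Op_Is_Empty x) = 0"
| "cost (Op_Min x) = 0"
| "cost (Op_Union x y) = T_meld x y"
| "cost (Op_Delmin \<langle>t, a, u\<rangle>) = T_meld t u"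
| "cost (Op_Delmin \<langle>\<rangle>) = 0"

text \<open>
  The state is the multiset of heaps at hand. Following the convention of amortized analysis,
  \<open>Op_Union\<close> and \<open>Op_Delmin\<close> consume their arguments, so a heap cannot be used twice.
  The two queries change nothing.
\<close>

inductive step ::
    "bias \<Rightarrow> 'a::linorder tree multiset \<Rightarrow> 'a heap_op \<Rightarrow> 'a tree multiset \<Rightarrow> bool"
  for v where
  empty: "step v M Op_Empty (add_mset \<langle>\<rangle> M)"
| single: "step v M (Op_Single a) (add_mset \<langle>\<langle>\<rangle>, a, \<langle>\<rangle>\<rangle> M)"
| is_empty: "x \<in># M \<Longrightarrow> step v M (Op_Is_Empty x) M"
| minimum: "x \<in># M \<Longrightarrow> step v M (Op_Min x) M"
| union: "step v (add_mset x (add_mset y M)) (Op_Union x y) (add_mset (meld v x y) M)"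
| delmin: "step v (add_mset \<langle>t, a, u\<rangle> M) (Op_Delmin \<langle>t, a, u\<rangle>) (add_mset (meld v t u) M)"

definition run ::
    "bias \<Rightarrow> (nat \<Rightarrow> 'a::linorder heap_op) \<Rightarrow> (nat \<Rightarrow> 'a tree multiset) \<Rightarrow> bool" where
  "run v ops M \<longleftrightarrow> M 0 = {#} \<and> (\<forall>i. step v (M i) (ops i) (M (Suc i)))"

definition phi :: real where
  "phi = (sqrt 5 + 1) / 2"

end

theory Submission
  imports Defs
begin

text \<open>
  Melding costs exactly the sum of the two ranks. Consider the tree shapes
  \<open>C (n+3) = \<langle>\<langle>C (n+1), C n\<rangle>, C (n+1)\<rangle>\<close>, \<open>A (n+2) = \<langle>C n, A n\<rangle>\<close> and
  \<open>U n = \<langle>A (n+1), A n\<rangle>\<close>, with suitable small initial trees. Their sizes grow like Fibonacci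
  numbers and \<open>rank (A n) = n div 2\<close>. If the right spines are interleaved strictly alternately,
  then \<open>A (n+1) \<oplus> A n = C (n+1)\<close> and hence \<open>U (n+1) \<oplus> U n = U (n+2)\<close>, for both kinds of bias. So
  every \<open>U n\<close> can be built from singletons by unions alone; as \<open>|U n| \<le> 2 * phi ^ n\<close>, all these unions
  and a final \<open>delmin\<close> on \<open>U n\<close> are as expensive as claimed, with \<open>c = log phi 2\<close>. The alternation is
  possible for every labelling of the final \<open>U n\<close> that increases strictly along all paths, because
  a meld can be undone starting from its result.
\<close>

section \<open>Cost and invariants of melding\<close>

text \<open>Each recursive call moves one step down the right spine of one argument, and the
  recursion ends only when both spines are exhausted.\<close>

lemma T_meld_eq_rank: "T_meld x y = rank x + rank y"
  by (induction x y rule: T_meld.induct) auto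

lemma rank_map_tree [simp]: "rank (map_tree f t) = rank t"
  by (induction t) auto

lemma key_map_tree [simp]: "key v (map_tree f t) = key v t"
  by (cases v) auto

lemma set_bal [simp]: "set_tree (bal v t a u) = insert a (set_tree t \<union> set_tree u)"
  by (auto simp: bal_def)

lemma set_meld [simp]: "set_tree (meld v x y) = set_tree x \<union> set_tree y"
  by (induction v x y rule: meld.induct) auto

lemma heap_bal: "heap (bal v t a u) \<longleftrightarrow> heap \<langle>t, a, u\<rangle>"
  by (auto simp: bal_def)

lemma heap_meld: "heap x \<Longrightarrow> heap y \<Longrightarrow> heap (meld v x y)"
proof (induction v x y rule: meld.induct)
  case (4 v t a u s b w)
  show ?case
  proof (cases "a \<le> b")
    case True
    with 4 show ?thesis by (auto simp: heap_bal intro: order_trans)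
  next
    case False
    with 4 show ?thesis by (auto simp: heap_bal intro: order_trans)
  qed
qed (auto simp: heap_bal)

lemma leftist_bal: "leftist v t \<Longrightarrow> leftist v u \<Longrightarrow> leftist v (bal v t a u)"
  by (auto simp: bal_def)

lemma leftist_meld: "leftist v x \<Longrightarrow> leftist v y \<Longrightarrow> leftist v (meld v x y)"
  by (induction v x y rule: meld.induct) (auto simp: leftist_bal)

section \<open>The tree shapes\<close>

text \<open>The values of \<open>size1 (C n)\<close> are the Fibonacci numbers 1, 1, 2, 3, 5, 8 and
  so on. Labels are trivial because only the shape matters here.\<close>

fun C :: "nat \<Rightarrow> unit tree" where
  "C 0 = \<langle>\<rangle>"
| "C (Suc 0) = \<langle>\<rangle>"
| "C (Suc (Suc 0)) = \<langle>\<langle>\<rangle>, (), \<langle>\<rangle>\<rangle>"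
| "C (Suc (Suc (Suc n))) = \<langle>\<langle>C (Suc n), (), C n\<rangle>, (), C (Suc n)\<rangle>"

fun A :: "nat \<Rightarrow> unit tree" where
  "A 0 = \<langle>\<rangle>"
| "A (Suc 0) = \<langle>\<rangle>"
| "A (Suc (Suc n)) = \<langle>C n, (), A n\<rangle>"

definition U :: "nat \<Rightarrow> unit tree" where
  "U n = \<langle>A (Suc n), (), A n\<rangle>"

lemma rank_C: "rank (C n) = n div 2"
  by (induction n rule: C.induct) auto

lemma rank_A: "rank (A n) = n div 2"
  by (induction n rule: A.induct) auto

lemma size_C_mono: "size (C n) \<le> size (C (Suc n))"
  by (induction n rule: C.induct) auto

lemma size_A_le_C: "size (A n) \<le> size (C n)"
proof (induction n rule: A.induct)
  case (3 n)
  then show ?case by (cases n) auto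
qed auto

lemma size_A_mono: "size (A n) \<le> size (A (Suc n))"
proof (induction n rule: A.induct)
  case (3 n)
  then show ?case using size_C_mono[of n] by simp
qed auto

text \<open>This bound and the next three make \<open>bal\<close> swap in every meld considered
  below, for both kinds of bias. Weak inequalities suffice because ties swap too.\<close>

lemma key_C_mono: "key v (C n) \<le> key v (C (Suc n))"
  by (cases v) (auto simp: size_C_mono rank_C div_le_mono)

lemma key_A_le_C: "key v (A n) \<le> key v (C n)"
  by (cases v) (auto simp: size_A_le_C rank_A rank_C)

lemma key_A_mono: "key v (A n) \<le> key v (A (Suc n))"
  by (cases v) (auto simp: size_A_mono rank_A div_le_mono)

lemma key_C_node: "key v (C (Suc n)) \<le> key v \<langle>C (Suc n), (), C n\<rangle>"
  by (cases v) (auto simp: rank_C)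

section \<open>Fibonacci growth of the sizes\<close>

lemma size1_C_eq: "size1 (C (Suc n)) + 1 = size1 (A (Suc n)) + size1 (A n)"
  by (induction n rule: A.induct) auto

text \<open>The left subtree \<open>C (n+1)\<close> of \<open>A (n+3)\<close> accounts for
  \<open>U n\<close>, the rest for \<open>U (n+1)\<close>. Hence \<open>size1 (U n) - 1\<close> runs
  through 1, 2, 3, 5, 8 and so on.\<close>

lemma size1_U_eq: "size1 (U (Suc (Suc n))) + 1 = size1 (U (Suc n)) + size1 (U n)"
  using size1_C_eq[of n] by (simp add: U_def)

lemma size1_U_ge: "n + 2 \<le> size1 (U n)"
proof (induction n rule: induct_nat_012)
  case (ge2 n)
  then show ?case using size1_U_eq[of n] by simp
qed (auto simp: U_def)

lemma phi_gt_1: "phi > 1"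
  using real_less_rsqrt[of 1 5] by (simp add: phi_def)

lemma phi_square: "phi ^ 2 = phi + 1"
  by (simp add: phi_def power2_eq_square field_simps)

lemma phi_power_Suc_Suc: "phi ^ Suc (Suc n) = phi ^ Suc n + phi ^ n"
proof -
  have "phi ^ Suc (Suc n) = phi ^ 2 * phi ^ n" by (simp add: power2_eq_square)
  also have "\<dots> = phi ^ Suc n + phi ^ n" by (simp add: phi_square distrib_right)
  finally show ?thesis .
qed

lemma log_phi_2_less: "log phi 2 < 2"
proof -
  have "2 < phi ^ 2" using phi_gt_1 phi_square by simp
  then show ?thesis using phi_gt_1 by (simp add: log_less_iff)
qed

lemma size1_U_le: "real (size1 (U n)) \<le> 2 * phi ^ n"
proof (induction n rule: induct_nat_012)
  case 1
  \<comment> \<open>Needed because \<open>U 1\<close> has \<open>size1\<close> 3. The factor 2 in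
    the bound is forced by \<open>U 0\<close>, where equality holds.\<close>
  have "3 / 2 \<le> phi"
    using real_le_rsqrt[of 2 5] by (simp add: phi_def)
  then show ?case by (simp add: U_def)
next
  case (ge2 n)
  have "real (size1 (U (Suc (Suc n)))) \<le> real (size1 (U (Suc n))) + real (size1 (U n))"
    using size1_U_eq[of n] by linarith
  also have "\<dots> \<le> 2 * phi ^ Suc n + 2 * phi ^ n" using ge2 by linarith
  finally show ?case by (simp only: phi_power_Suc_Suc distrib_left)
qed (simp add: U_def)

lemma log_phi_le:
  assumes "0 < n" "real n \<le> 2 * phi ^ k"
  shows "log phi (real n) - log phi 2 \<le> real k"
proof -
  have "log phi (real n) \<le> log phi (2 * phi ^ k)"
    using assms phi_gt_1 by simp
  also have "\<dots> = log phi 2 + real k"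
    using phi_gt_1 by (simp add: log_mult log_nat_power)
  finally show ?thesis by simp
qed

section \<open>Undoing a meld\<close>

text \<open>Strictness along paths decides every comparison that matters when a meld is undone;
  equal labels in disjoint subtrees are harmless.\<close>

fun strict_heap :: "'a::linorder tree \<Rightarrow> bool" where
  "strict_heap \<langle>\<rangle> = True"
| "strict_heap \<langle>t, a, u\<rangle> =
    ((\<forall>b \<in> set_tree t \<union> set_tree u. a < b) \<and> strict_heap t \<and> strict_heap u)"

definition shape :: "'a tree \<Rightarrow> unit tree" where
  "shape = map_tree (\<lambda>_. ())"

lemma shape_simps [simp]:
  "shape \<langle>\<rangle> = \<langle>\<rangle>" "shape \<langle>t, a, u\<rangle> = \<langle>shape t, (), shape u\<rangle>"
  by (auto simp: shape_def)

lemma shape_eq_Leaf [simp]: "shape t = \<langle>\<rangle> \<longleftrightarrow> t = \<langle>\<rangle>"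
  by (cases t) auto

lemma shape_eq_Node:
  "shape t = \<langle>l, x, r\<rangle> \<longleftrightarrow> (\<exists>t1 a t2. t = \<langle>t1, a, t2\<rangle> \<and> shape t1 = l \<and> shape t2 = r)"
  by (cases t) auto

lemma rank_shape: "shape t = s \<Longrightarrow> rank t = rank s"
  by (auto simp: shape_def)

lemma size1_shape: "shape t = s \<Longrightarrow> size1 t = size1 s"
  by (auto simp: shape_def)

lemma key_shape: "key v (shape t) = key v t"
  by (simp add: shape_def)

lemma key_node_cong:
  "key v \<langle>t, a, u\<rangle> = key v \<langle>shape t, (), shape u\<rangle>"
  by (cases v) (simp_all add: shape_def)

text \<open>The root takes the minimum, and both subtrees may draw on the same remaining labels, so
  as many labels as the height suffice.\<close>

lemma ex_strict_heap:
  fixes S :: "'a::linorder set"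
  assumes "finite S" "height s \<le> card S"
  shows "\<exists>z. strict_heap z \<and> shape z = s \<and> set_tree z \<subseteq> S"
  using assms
proof (induction s arbitrary: S)
  case Leaf
  show ?case by (rule exI[of _ "\<langle>\<rangle>"]) simp
next
  case (Node l x r)
  then have "S \<noteq> {}" by auto
  define a where "a = Min S"
  have a: "a \<in> S" "\<And>b. b \<in> S - {a} \<Longrightarrow> a < b"
    using Node.prems \<open>S \<noteq> {}\<close> by (auto simp: a_def order.not_eq_order_implies_strict)
  have "height l \<le> card (S - {a})" "height r \<le> card (S - {a})"
    using Node.prems a(1) by auto
  then obtain t u where
    "strict_heap t" "shape t = l" "set_tree t \<subseteq> S - {a}"
    "strict_heap u" "shape u = r" "set_tree u \<subseteq> S - {a}"
    using Node.IH[of "S - {a}"] Node.prems(1) by (metis finite_Diff)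
  with a show ?case by (intro exI[of _ "\<langle>t, a, u\<rangle>"]) auto
qed

text \<open>Two rounds of melding, one on each spine: first \<open>a\<close> wins, then
  \<open>b\<close>, and both calls of \<open>bal\<close> swap.\<close>

lemma meld_alternate:
  assumes "meld v x y = p" "a < b" "\<forall>d \<in> set_tree x. b < d"
    and "key v q \<le> key v p" "key v r \<le> key v \<langle>p, b, q\<rangle>"
  shows "meld v \<langle>r, a, x\<rangle> \<langle>q, b, y\<rangle> = \<langle>\<langle>p, b, q\<rangle>, a, r\<rangle>"
proof -
  have "meld v x \<langle>q, b, y\<rangle> = bal v q b p"
    using assms(1,3) by (cases x) auto
  with assms show ?thesis by (simp add: bal_def less_imp_le)
qed

text \<open>The tree \<open>z\<close> is given and its arguments are recovered: the two topmost
  spine nodes are split off and \<open>p\<close> is undone recursively. Tracking the labels keeps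
  the rebuilt arguments strict heaps.\<close>

lemma meld_A:
  assumes "strict_heap z" "shape z = C (Suc n)"
  shows "\<exists>x y. strict_heap x \<and> strict_heap y \<and> shape x = A (Suc n) \<and> shape y = A n \<and>
    set_tree x \<union> set_tree y \<subseteq> set_tree z \<and> meld v x y = z"
  using assms
proof (induction n arbitrary: z rule: A.induct)
  case 1
  then show ?case by (intro exI[of _ "\<langle>\<rangle>"]) auto
next
  case 2
  then obtain a where "z = \<langle>\<langle>\<rangle>, a, \<langle>\<rangle>\<rangle>" by (auto simp: shape_eq_Node)
  then show ?case by (intro exI[of _ z] exI[of _ "\<langle>\<rangle>"]) (auto simp: bal_def)
next
  case (3 n)
  from "3.prems" obtain p b q a r where z: "z = \<langle>\<langle>p, b, q\<rangle>, a, r\<rangle>"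
    and sh: "shape p = C (Suc n)" "shape q = C n" "shape r = C (Suc n)"
    by (auto simp: shape_eq_Node)
  then have "strict_heap p" using "3.prems" by simp
  then obtain x y where xy: "strict_heap x" "strict_heap y" "shape x = A (Suc n)"
      "shape y = A n" "set_tree x \<union> set_tree y \<subseteq> set_tree p" "meld v x y = p"
    using "3.IH"[of p] sh(1) by blast
  have "meld v \<langle>r, a, x\<rangle> \<langle>q, b, y\<rangle> = z"
    unfolding z
  proof (rule meld_alternate)
    show "key v q \<le> key v p"
      using key_C_mono[of v n] sh by (metis key_shape)
    show "key v r \<le> key v \<langle>p, b, q\<rangle>"
      using key_C_node[of v n] sh by (metis key_shape key_node_cong)
  qed (use xy "3.prems" z in auto)
  with xy sh "3.prems" z show ?case
    by (intro exI[of _ "\<langle>r, a, x\<rangle>"] exI[of _ "\<langle>q, b, y\<rangle>"]) auto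
qed

lemma meld_U:
  assumes "strict_heap z" "shape z = U (Suc (Suc n))"
  shows "\<exists>x y. strict_heap x \<and> strict_heap y \<and> shape x = U (Suc n) \<and> shape y = U n \<and> meld v x y = z"
proof -
  obtain p b q a r where z: "z = \<langle>\<langle>p, b, q\<rangle>, a, r\<rangle>"
    and sh: "shape p = C (Suc n)" "shape q = A (Suc n)" "shape r = A (Suc (Suc n))"
    using assms by (auto simp: U_def shape_eq_Node)
  then obtain x y where xy: "strict_heap x" "strict_heap y" "shape x = A (Suc n)"
      "shape y = A n" "set_tree x \<union> set_tree y \<subseteq> set_tree p" "meld v x y = p"
    using meld_A[of p n v] assms by auto
  have "meld v \<langle>r, a, x\<rangle> \<langle>q, b, y\<rangle> = z"
    unfolding z
  proof (rule meld_alternate)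
    show "key v q \<le> key v p"
      using key_A_le_C[of v "Suc n"] sh by (metis key_shape)
    show "key v r \<le> key v \<langle>p, b, q\<rangle>"
      using key_A_mono[of v "Suc (Suc n)"] sh by (metis key_shape key_node_cong A.simps(3))
  qed (use xy assms z in auto)
  with xy sh assms z show ?thesis
    by (intro exI[of _ "\<langle>r, a, x\<rangle>"] exI[of _ "\<langle>q, b, y\<rangle>"]) (auto simp: U_def)
qed

section \<open>Runs\<close>

definition expensive :: "'a::linorder heap_op \<Rightarrow> bool" where
  "expensive op = (case op of
      Op_Empty \<Rightarrow> cost op = 0
    | Op_Is_Empty x \<Rightarrow> cost op = 0
    | Op_Min x \<Rightarrow> cost op = 0
    | Op_Single a \<Rightarrow> cost op = 0
    | Op_Delmin x \<Rightarrow> real (cost op) \<ge> log phi (real (size1 x)) - log phi 2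
    | Op_Union x y \<Rightarrow> real (cost op) \<ge> log phi (real (size1 x + size1 y)) - log phi 2)"

definition estep ::
    "bias \<Rightarrow> 'a::linorder heap_op \<Rightarrow> 'a tree multiset \<Rightarrow> 'a tree multiset \<Rightarrow> bool" where
  "estep v op M M' \<longleftrightarrow> step v M op M' \<and> expensive op"

abbreviation esteps :: "bias \<Rightarrow> 'a::linorder tree multiset \<Rightarrow> 'a tree multiset \<Rightarrow> bool" where
  "esteps v \<equiv> (\<lambda>M M'. \<exists>op. estep v op M M')\<^sup>*\<^sup>*"

lemma rank_U: "rank (U n) = Suc (n div 2)"
  by (simp add: U_def rank_A)

text \<open>The ranks add up to \<open>n + 2\<close>, since the halves of \<open>n\<close> and
  \<open>n + 1\<close>, rounded down, sum to \<open>n\<close>. This matches the exponent bounding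
  the joint size.\<close>

lemma expensive_union_U:
  assumes "shape x = U (Suc n)" "shape y = U n"
  shows "expensive (Op_Union x y)"
proof -
  have "real (size1 x + size1 y) \<le> 2 * phi ^ Suc n + 2 * phi ^ n"
    using size1_U_le[of n] size1_U_le[of "Suc n"] assms[THEN size1_shape] by simp
  then have "real (size1 x + size1 y) \<le> 2 * phi ^ Suc (Suc n)"
    by (simp only: phi_power_Suc_Suc distrib_left)
  moreover have "T_meld x y = Suc (Suc n)"
    using assms[THEN rank_shape] by (simp add: T_meld_eq_rank rank_U)
  moreover have "0 < size1 x + size1 y" by simp
  ultimately show ?thesis
    using log_phi_le[of "size1 x + size1 y" "Suc (Suc n)"] by (simp add: expensive_def)
qed

text \<open>This union creates \<open>U 1\<close> from two copies of \<open>U 0\<close>, the only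
  one whose arguments do not have consecutive indices.\<close>

lemma expensive_union_single:
  "expensive (Op_Union \<langle>\<langle>\<rangle>, a, \<langle>\<rangle>\<rangle> \<langle>\<langle>\<rangle>, b, \<langle>\<rangle>\<rangle>)"
  using log_phi_le[of 4 2] phi_gt_1 phi_square by (simp add: expensive_def T_meld_eq_rank)

lemma expensive_delmin_U:
  assumes "shape x = U n"
  shows "expensive (Op_Delmin x)"
proof -
  obtain t a u where x: "x = \<langle>t, a, u\<rangle>" "shape t = A (Suc n)" "shape u = A n"
    using assms by (auto simp: U_def shape_eq_Node)
  then have "T_meld t u = n"
    using rank_shape[of t] rank_shape[of u] by (simp add: T_meld_eq_rank rank_A)
  moreover have "real (size1 x) \<le> 2 * phi ^ n"
    using size1_U_le[of n] size1_shape[OF assms] by simp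
  ultimately show ?thesis
    using log_phi_le[of "size1 x" n] by (simp add: expensive_def x)
qed

text \<open>Both arguments of the last union are built one after the other beside the heaps already
  at hand, hence the arbitrary \<open>M\<close>.\<close>

lemma esteps_U:
  assumes "strict_heap z" "shape z = U n"
  shows "esteps v M (add_mset z M)"
  using assms
proof (induction n arbitrary: z M rule: induct_nat_012)
  case 0
  then obtain a where "z = \<langle>\<langle>\<rangle>, a, \<langle>\<rangle>\<rangle>" by (auto simp: U_def shape_eq_Node)
  then have "estep v (Op_Single a) M (add_mset z M)"
    by (auto simp: estep_def expensive_def intro: step.single)
  then show ?case by blast
next
  case 1
  then obtain a b where z: "z = \<langle>\<langle>\<langle>\<rangle>, b, \<langle>\<rangle>\<rangle>, a, \<langle>\<rangle>\<rangle>" "a < b"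
    by (auto simp: U_def shape_eq_Node)
  let ?s = "\<lambda>a. \<langle>\<langle>\<rangle>, a, \<langle>\<rangle>\<rangle>"
  have "meld v (?s a) (?s b) = z"
    unfolding z by (rule meld_alternate) (use z(2) in \<open>cases v; auto\<close>)+
  then have "estep v (Op_Union (?s a) (?s b)) (add_mset (?s a) (add_mset (?s b) M)) (add_mset z M)"
    using step.union[of v "?s a" "?s b" M] by (simp add: estep_def expensive_union_single)
  then have union: "esteps v (add_mset (?s a) (add_mset (?s b) M)) (add_mset z M)"
    by blast
  have single: "esteps v N (add_mset (?s c) N)" for c N
  proof -
    have "estep v (Op_Single c) N (add_mset (?s c) N)"
      by (auto simp: estep_def expensive_def intro: step.single)
    then show ?thesis by blast
  qed
  show ?case
    by (rule rtranclp_trans[OF single rtranclp_trans[OF single union]])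
next
  case (ge2 n)
  obtain x y where xy: "strict_heap x" "strict_heap y" "shape x = U (Suc n)" "shape y = U n"
      "meld v x y = z"
    using meld_U[OF ge2.prems] by blast
  have "estep v (Op_Union x y) (add_mset x (add_mset y M)) (add_mset z M)"
    using step.union[of v x y M] xy expensive_union_U by (auto simp: estep_def)
  then have "esteps v (add_mset x (add_mset y M)) (add_mset z M)"
    by blast
  then show ?case
    using ge2.IH xy by (blast intro: rtranclp_trans)
qed

text \<open>
  \<open>m\<close> more expensive steps lead from \<open>M\<close> to a state in which an expensive \<open>delmin\<close> on a heap of size
  at least \<open>k\<close> can be executed. An infinite run decreases \<open>m\<close> and, after each such \<open>delmin\<close>, increases \<open>k\<close>.
\<close>

fun towards :: "bias \<Rightarrow> nat \<Rightarrow> nat \<Rightarrow> 'a::linorder tree multiset \<Rightarrow> bool" where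
  "towards v k 0 M = (\<exists>x M'. estep v (Op_Delmin x) M M' \<and> k \<le> size1 x)"
| "towards v k (Suc m) M = (\<exists>op M'. estep v op M M' \<and> towards v k m M')"

lemma towards_esteps:
  assumes "esteps v M M'" "towards v k m M'"
  shows "\<exists>m. towards v k m M"
  using assms
proof (induction rule: converse_rtranclp_induct)
  case (step M N)
  then obtain op m where "estep v op M N" "towards v k m N" by blast
  then have "towards v k (Suc m) M" by auto
  then show ?case by blast
qed blast

lemma ex_towards:
  fixes M :: "'a::linorder tree multiset"
  assumes "infinite (UNIV :: 'a set)"
  shows "\<exists>m. towards v k m M"
proof -
  \<comment> \<open>An infinite linear order may lack an infinite ascending sequence, but it has
    finite subsets of every size; labels are chosen anew for each \<open>k\<close>.\<close>
  obtain S :: "'a set" where "finite S" "card S = height (U k)"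
    using infinite_arbitrarily_large[OF assms] by blast
  then obtain z :: "'a tree" where z: "strict_heap z" "shape z = U k"
    using ex_strict_heap[of S "U k"] by auto
  then obtain t a u where "z = \<langle>t, a, u\<rangle>" by (auto simp: U_def shape_eq_Node)
  then have "estep v (Op_Delmin z) (add_mset z M) (add_mset (meld v t u) M)"
    using expensive_delmin_U[OF z(2)] step.delmin by (auto simp: estep_def)
  moreover have "k \<le> size1 z"
    using size1_U_ge[of k] size1_shape[OF z(2)] by simp
  ultimately have "towards v k 0 (add_mset z M)" by auto
  then show ?thesis using towards_esteps esteps_U[OF z] by blast
qed

text \<open>Dependent choice joins the finite stretches given by \<open>ex_towards\<close>. It
  yields only the states with their counters; the operations are chosen afterwards.\<close>

lemma ex_expensive_run:
  assumes "infinite (UNIV :: 'a::linorder set)"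
  shows "\<exists>(ops :: nat \<Rightarrow> 'a heap_op) M. M 0 = {#} \<and> (\<forall>i. estep v (ops i) (M i) (M (Suc i))) \<and>
    (\<forall>k. \<exists>i x. ops i = Op_Delmin x \<and> k \<le> size1 x)"
proof -
  \<comment> \<open>The clause for \<open>i = 0\<close> fixes the start with no heaps and target 0,
    so that the targets run through all natural numbers.\<close>
  let ?P = "\<lambda>(i :: nat) (M :: 'a tree multiset, k, m). towards v k m M \<and> (i = 0 \<longrightarrow> M = {#} \<and> k = 0)"
  let ?E = "\<lambda>(M, k, m) (M' :: 'a tree multiset, k', m') op. estep v op M M' \<and>
    (case m of 0 \<Rightarrow> k' = Suc k \<and> (\<exists>x. op = Op_Delmin x \<and> k \<le> size1 x)
     | Suc n \<Rightarrow> k' = k \<and> m' = n)"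
  let ?Q = "\<lambda>i :: nat. \<lambda>s s'. \<exists>op. ?E s s' op"
  have "\<exists>f. \<forall>i. ?P i (f i) \<and> ?Q i (f i) (f (Suc i))"
  proof (rule dependent_nat_choice)
    show "\<exists>s. ?P 0 s"
      using ex_towards[OF assms] by auto
  next
    fix i s
    assume P: "?P i s"
    obtain M k m where s: "s = (M, k, m)" by (cases s) auto
    show "\<exists>s'. ?P (Suc i) s' \<and> ?Q i s s'"
    proof (cases m)
      case 0
      with P s obtain x M' where "estep v (Op_Delmin x) M M'" "k \<le> size1 x" by auto
      moreover obtain m' where "towards v (Suc k) m' M'" using ex_towards[OF assms] by blast
      ultimately show ?thesis using s 0 by (intro exI[of _ "(M', Suc k, m')"]) auto
    next
      case (Suc n)
      with P s obtain op M' where "estep v op M M'" "towards v k n M'" by auto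
      then show ?thesis using s Suc by (intro exI[of _ "(M', k, n)"]) auto
    qed
  qed
  then obtain f where "\<forall>i. ?P i (f i) \<and> ?Q i (f i) (f (Suc i))" ..
  then have f: "?P i (f i)" and "\<exists>op. ?E (f i) (f (Suc i)) op" for i
    by (simp_all only:)
  then obtain ops where ops: "\<And>i. ?E (f i) (f (Suc i)) (ops i)"
    using choice[of "\<lambda>i. ?E (f i) (f (Suc i))"] by auto
  define M k m where "M i = fst (f i)" and "k i = fst (snd (f i))" and "m i = snd (snd (f i))" for i
  have f_eq: "f i = (M i, k i, m i)" for i by (simp add: M_def k_def m_def)
  have estep: "estep v (ops i) (M i) (M (Suc i))" for i
    using ops[of i] by (simp add: f_eq)
  have done': "k (Suc i) = Suc (k i)" "\<exists>x. ops i = Op_Delmin x \<and> k i \<le> size1 x" if "m i = 0" for i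
    using ops[of i] that by (simp_all add: f_eq)
  have next': "k (Suc i) = k i \<and> m (Suc i) = n" if "m i = Suc n" for i n
    using ops[of i] that by (simp add: f_eq)
  \<comment> \<open>The countdown \<open>m\<close> reaches 0 while the target \<open>k\<close> stays
    fixed, so no target is pursued forever.\<close>
  have fin: "\<exists>j. k j = k i \<and> m j = 0" for i
  proof (induction "m i" arbitrary: i)
    case (Suc n)
    then show ?case using next'[of i n] by metis
  qed auto
  have "\<exists>i. k i = l \<and> m i = 0" for l
  proof (induction l)
    case 0
    then show ?case using f[of 0] fin[of 0] by (simp add: f_eq)
  next
    case (Suc l)
    then show ?case using fin done'(1) by metis
  qed
  then have "\<exists>i x. ops i = Op_Delmin x \<and> l \<le> size1 x" for l
    using done'(2) by metis
  moreover have "M 0 = {#}" using f[of 0] by (simp add: f_eq)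
  ultimately show ?thesis using estep by blast
qed

lemma step_preserves_leftist_heaps:
  assumes "step v M op M'" "\<forall>x \<in># M. heap x \<and> leftist v x"
  shows "\<forall>x \<in># M'. heap x \<and> leftist v x"
  using assms by (induction rule: step.induct) (auto simp: heap_meld leftist_meld)

theorem theorem2:
  assumes "infinite (UNIV :: 'a::linorder set)"
  shows "\<exists>c::real. c < 2 \<and>
    (\<forall>v::bias. \<exists>(ops :: nat \<Rightarrow> 'a heap_op) (M :: nat \<Rightarrow> 'a tree multiset).
      run v ops M \<and>
      (\<forall>i. \<forall>x \<in># M i. heap x \<and> leftist v x) \<and>
      (\<forall>n. \<exists>i. \<exists>x \<in># M i. n \<le> size1 x) \<and>
      (\<forall>n. \<exists>i x. ops i = Op_Delmin x \<and> n \<le> size1 x) \<and>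
      (\<forall>i. case ops i of
          Op_Empty \<Rightarrow> cost (ops i) = 0
        | Op_Is_Empty x \<Rightarrow> cost (ops i) = 0
        | Op_Min x \<Rightarrow> cost (ops i) = 0
        | Op_Single a \<Rightarrow> cost (ops i) = 0
        | Op_Delmin x \<Rightarrow> real (cost (ops i)) \<ge> log phi (real (size1 x)) - c
        | Op_Union x y \<Rightarrow> real (cost (ops i)) \<ge> log phi (real (size1 x + size1 y)) - c))"
proof (rule exI[of _ "log phi 2"], intro conjI allI)
  show "log phi 2 < 2" by (rule log_phi_2_less)
next
  fix v
  obtain ops :: "nat \<Rightarrow> 'a heap_op" and M where M: "M 0 = {#}"
    and estep: "\<And>i. estep v (ops i) (M i) (M (Suc i))"
    and delmin: "\<And>k. \<exists>i x. ops i = Op_Delmin x \<and> k \<le> size1 x"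
    using ex_expensive_run[OF assms] by metis
  have step: "step v (M i) (ops i) (M (Suc i))" and exp: "expensive (ops i)" for i
    using estep by (auto simp: estep_def)
  have "\<forall>x \<in># M i. heap x \<and> leftist v x" for i
    by (induction i) (auto simp: M dest: step_preserves_leftist_heaps[OF step])
  moreover have "\<exists>i. \<exists>x \<in># M i. n \<le> size1 x" for n
  proof -
    obtain i x where "ops i = Op_Delmin x" "n \<le> size1 x" using delmin by blast
    \<comment> \<open>A \<open>delmin\<close> acts only on a heap at hand, so its unbounded
      arguments also show that the heaps get arbitrarily large.\<close>
    moreover from this step[of i] have "x \<in># M i" by (auto elim: step.cases)
    ultimately show ?thesis by blast
  qed
  moreover have "run v ops M" using M step by (simp add: run_def)
  ultimately show "\<exists>(ops :: nat \<Rightarrow> 'a heap_op) (M :: nat \<Rightarrow> 'a tree multiset).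
      run v ops M \<and>
      (\<forall>i. \<forall>x \<in># M i. heap x \<and> leftist v x) \<and>
      (\<forall>n. \<exists>i. \<exists>x \<in># M i. n \<le> size1 x) \<and>
      (\<forall>n. \<exists>i x. ops i = Op_Delmin x \<and> n \<le> size1 x) \<and>
      (\<forall>i. case ops i of
          Op_Empty \<Rightarrow> cost (ops i) = 0
        | Op_Is_Empty x \<Rightarrow> cost (ops i) = 0
        | Op_Min x \<Rightarrow> cost (ops i) = 0
        | Op_Single a \<Rightarrow> cost (ops i) = 0
        | Op_Delmin x \<Rightarrow> real (cost (ops i)) \<ge> log phi (real (size1 x)) - log phi 2
        | Op_Union x y \<Rightarrow> real (cost (ops i)) \<ge> log phi (real (size1 x + size1 y)) - log phi 2)"
    using delmin exp unfolding expensive_def by blast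
qed

end
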